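(* Let $x$ be a number. If $|x|>1$, then $x$ is strongly decomposable, and the only strong decompositions of $x$ are sums of numbers; that is, whenever $G$ and $H$ are nonzero games with $x=G+H$ and $b(G)+b(H)=b(x)$, both $G$ and $H$ are equal to numbers.
   Context: All games are short (finite) two-player partizan combinatorial games under normal play (a player who cannot move loses). $+$ denotes the disjunctive sum, and $=$ denotes the usual equality of game values. A number is a short game equal to a dyadic rational (an integer or an irreducible fraction whose denominator is a power of $2$), with the usual identification of dyadic rationals with game values. The birthday $b(G)$ is the height of the game tree of the canonical form of $G$. A game $G$ is strongly decomposable if there are games $H$ and $J$, both different from zero (as game values), such that $b(H)+b(J)=b(G)$ and $G=H+J$. Such an expression $G=H+J$ is called a strong decomposition of $G$. *)

theory Defs
  imports Complex_Main "HOL-Library.FSet"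
begin

text \<open>
  Forms of short partizan games. Formal identity of forms is HOL equality; equality of game
  values is the relation \<open>\<approx>\<close> below.
\<close>

datatype game = Game (left_opts: "game fset") (right_opts: "game fset")

lemma size_left_option:
  assumes "X |\<in>| left_opts G"
  shows "size X < size G"
proof (cases G)
  case (Game L R)
  then have "Suc (size X) \<le> (\<Sum>Y\<in>fset L. Suc (size Y))"
    using assms by (intro member_le_sum) auto
  then show ?thesis
    using Game by simp
qed

lemma size_right_option:
  assumes "X |\<in>| right_opts G"
  shows "size X < size G"
proof (cases G)
  case (Game L R)
  then have "Suc (size X) \<le> (\<Sum>Y\<in>fset R. Suc (size Y))"
    using assms by (intro member_le_sum) auto
  then show ?thesis
    using Game by simp
qed

instantiation game :: "{zero, plus, uminus}"
begin

definition zero_game :: game where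
  "0 = Game {||} {||}"

primrec uminus_game :: "game \<Rightarrow> game" where
  "- Game L R = Game (uminus_game |`| R) (uminus_game |`| L)"

function plus_game :: "game \<Rightarrow> game \<Rightarrow> game" where
  "plus_game G H =
     Game ((\<lambda>X. plus_game X H) |`| left_opts G |\<union>| (\<lambda>Y. plus_game G Y) |`| left_opts H)
          ((\<lambda>X. plus_game X H) |`| right_opts G |\<union>| (\<lambda>Y. plus_game G Y) |`| right_opts H)"
  by pat_completeness auto
termination
  by (relation "measure (\<lambda>(G, H). size G + size H)")
     (auto dest: size_left_option size_right_option)

declare plus_game.simps [simp del]

instance ..

end

text \<open>
  Normal play. Since every play ends and there are no draws, Right wins \<open>G\<close> moving second
  iff Left does not win it moving first, and Right wins moving first iff Left does not win
  moving second; so the two predicates below determine the outcome class of \<open>G\<close>.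
\<close>

function left_wins_first :: "game \<Rightarrow> bool" and left_wins_second :: "game \<Rightarrow> bool" where
  "left_wins_first G \<longleftrightarrow> (\<exists>X |\<in>| left_opts G. left_wins_second X)"
| "left_wins_second G \<longleftrightarrow> (\<forall>X |\<in>| right_opts G. left_wins_first X)"
  by pat_completeness auto
termination
  by (relation "measure (case_sum size size)") (auto dest: size_left_option size_right_option)

declare left_wins_first.simps [simp del] left_wins_second.simps [simp del]

text \<open>
  \<open>G \<lesssim> H\<close>: in every context \<open>X\<close>, the outcome of \<open>H + X\<close> is at least as good for Left as that
  of \<open>G + X\<close>. Thus \<open>G \<approx> H\<close> says that \<open>G + X\<close> and \<open>H + X\<close> have the same outcome for all \<open>X\<close>.
\<close>

definition game_le :: "game \<Rightarrow> game \<Rightarrow> bool"  (infix "\<lesssim>" 50) where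
  "G \<lesssim> H \<longleftrightarrow> (\<forall>X. (left_wins_first (G + X) \<longrightarrow> left_wins_first (H + X)) \<and>
                   (left_wins_second (G + X) \<longrightarrow> left_wins_second (H + X)))"

definition game_eq :: "game \<Rightarrow> game \<Rightarrow> bool"  (infix "\<approx>" 50) where
  "G \<approx> H \<longleftrightarrow> G \<lesssim> H \<and> H \<lesssim> G"

definition has_dominated_option :: "game \<Rightarrow> bool" where
  "has_dominated_option G \<longleftrightarrow>
     (\<exists>X Y. X |\<in>| left_opts G \<and> Y |\<in>| left_opts G \<and> X \<noteq> Y \<and> X \<lesssim> Y) \<or>
     (\<exists>X Y. X |\<in>| right_opts G \<and> Y |\<in>| right_opts G \<and> X \<noteq> Y \<and> Y \<lesssim> X)"

definition has_reversible_option :: "game \<Rightarrow> bool" where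
  "has_reversible_option G \<longleftrightarrow>
     (\<exists>X Y. X |\<in>| left_opts G \<and> Y |\<in>| right_opts X \<and> Y \<lesssim> G) \<or>
     (\<exists>X Y. X |\<in>| right_opts G \<and> Y |\<in>| left_opts X \<and> G \<lesssim> Y)"

inductive canonical :: "game \<Rightarrow> bool" where
  canonicalI: "\<lbrakk>\<not> has_dominated_option G; \<not> has_reversible_option G;
    \<And>X. X |\<in>| left_opts G \<Longrightarrow> canonical X; \<And>X. X |\<in>| right_opts G \<Longrightarrow> canonical X\<rbrakk>
   \<Longrightarrow> canonical G"

definition canonical_form :: "game \<Rightarrow> game" where
  "canonical_form G = (THE K. canonical K \<and> K \<approx> G)"

text \<open>The height of a tree is its maximal number of edges from the root, so \<open>0\<close> has height 0.\<close>

primrec height :: "game \<Rightarrow> nat" where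
  "height (Game L R) = Max (insert 0 (Suc ` fset (height |`| L |\<union>| height |`| R)))"

definition birthday :: "game \<Rightarrow> nat" where
  "birthday G = height (canonical_form G)"

primrec nat_game :: "nat \<Rightarrow> game" where
  "nat_game 0 = 0"
| "nat_game (Suc n) = Game {|nat_game n|} {||}"

definition int_game :: "int \<Rightarrow> game" where
  "int_game m = (if 0 \<le> m then nat_game (nat m) else - nat_game (nat (- m)))"

text \<open>
  \<open>dyadic_game m k\<close> is the game of value m / 2^k: for odd m,
  m / 2^(k+1) = {(m-1)/2^(k+1) | (m+1)/2^(k+1)}.
\<close>

primrec dyadic_game :: "int \<Rightarrow> nat \<Rightarrow> game" where
  "dyadic_game m 0 = int_game m"
| "dyadic_game m (Suc k) =
     (if even m then dyadic_game (m div 2) k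
      else Game {|dyadic_game ((m - 1) div 2) k|} {|dyadic_game ((m + 1) div 2) k|})"

definition has_value :: "game \<Rightarrow> rat \<Rightarrow> bool" where
  "has_value G q \<longleftrightarrow> (\<exists>m k. q = of_int m / 2 ^ k \<and> G \<approx> dyadic_game m k)"

definition is_number :: "game \<Rightarrow> bool" where
  "is_number G \<longleftrightarrow> (\<exists>q. has_value G q)"

definition strong_decomposition :: "game \<Rightarrow> game \<Rightarrow> game \<Rightarrow> bool" where
  "strong_decomposition G H J \<longleftrightarrow>
     \<not> H \<approx> 0 \<and> \<not> J \<approx> 0 \<and> birthday H + birthday J = birthday G \<and> G \<approx> H + J"

definition strongly_decomposable :: "game \<Rightarrow> bool" where
  "strongly_decomposable G \<longleftrightarrow> (\<exists>H J. strong_decomposition G H J)"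

end

theory Submission
  imports Defs
begin

text \<open>
  Let \<open>x = G + H\<close> be a number. Put \<open>L G = inf {p. G \<lesssim> p}\<close> and \<open>R H = sup {p. p \<lesssim> H}\<close>, where \<open>p\<close> ranges
  over numbers. Since \<open>G \<lesssim> p\<close> iff \<open>x - p \<lesssim> H\<close>, we get \<open>x = L G + R H\<close>. If \<open>G\<close> is not a number,
  then neither is \<open>H\<close>, and then \<open>L G\<close> and \<open>R H\<close> are numbers born strictly before \<open>G\<close> and \<open>H\<close>:
  \<open>L G\<close> is the maximum of \<open>R X\<close> over the Left options \<open>X\<close> of the canonical form of \<open>G\<close>. As birthdays
  are subadditive, \<open>b x < b G + b H\<close>. A number \<open>x\<close> with \<open>\<bar>x\<bar> > 1\<close> decomposes as \<open>x = (x \<mp> 1) \<plusminus> 1\<close>.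
\<close>

subsection \<open>Order and group structure of games\<close>

lemma game_option_induct [case_names options]:
  assumes "\<And>G. \<lbrakk>\<And>X. X |\<in>| left_opts G \<Longrightarrow> P X; \<And>X. X |\<in>| right_opts G \<Longrightarrow> P X\<rbrakk> \<Longrightarrow> P G"
  shows "P G"
  by (induction G rule: measure_induct_rule[of size])
     (metis assms size_left_option size_right_option)

lemma left_opts_plus:
  "left_opts (G + H) = (\<lambda>X. X + H) |`| left_opts G |\<union>| (\<lambda>Y. G + Y) |`| left_opts H"
  by (subst plus_game.simps) simp

lemma right_opts_plus:
  "right_opts (G + H) = (\<lambda>X. X + H) |`| right_opts G |\<union>| (\<lambda>Y. G + Y) |`| right_opts H"
  by (subst plus_game.simps) simp

lemma left_opts_0 [simp]: "left_opts 0 = {||}"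
  and right_opts_0 [simp]: "right_opts 0 = {||}"
  by (simp_all add: zero_game_def)

lemma left_opts_uminus [simp]: "left_opts (- G) = uminus |`| right_opts G"
  and right_opts_uminus [simp]: "right_opts (- G) = uminus |`| left_opts G"
  by (cases G; simp)+

instance game :: comm_monoid_add
proof
  fix G H J :: game
  show "(G + H) + J = G + (H + J)"
  proof (induction "size G + size H + size J" arbitrary: G H J rule: less_induct)
    case less
    show ?case
      by (rule game.expand)
         (auto simp: left_opts_plus right_opts_plus fimage_funion fset.map_comp comp_def funion_assoc
           intro!: arg_cong2[of _ _ _ _ funion] fset.map_cong0 less
           dest: size_left_option size_right_option)
  qed
  show "G + H = H + G"
  proof (induction "size G + size H" arbitrary: G H rule: less_induct)
    case less
    have "(\<lambda>X. X + H) |`| left_opts G = (\<lambda>X. H + X) |`| left_opts G"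
      "(\<lambda>X. G + X) |`| left_opts H = (\<lambda>X. X + G) |`| left_opts H"
      "(\<lambda>X. X + H) |`| right_opts G = (\<lambda>X. H + X) |`| right_opts G"
      "(\<lambda>X. G + X) |`| right_opts H = (\<lambda>X. X + G) |`| right_opts H"
      by (auto intro!: fset.map_cong0 less dest: size_left_option size_right_option)
    then show ?case
      by (intro game.expand) (simp add: left_opts_plus right_opts_plus funion_commute)
  qed
  show "0 + G = G"
  proof (induction G rule: game_option_induct)
    case (options G)
    have "(+) 0 |`| left_opts G = (\<lambda>X. X) |`| left_opts G" "(+) 0 |`| right_opts G = (\<lambda>X. X) |`| right_opts G"
      by (intro fset.map_cong0 options; assumption)+
    then show ?case
      by (intro game.expand) (simp add: left_opts_plus right_opts_plus)
  qed
qed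

lemma uminus_uminus_game [simp]: "- (- G) = (G :: game)"
proof (induction G rule: game_option_induct)
  case (options G)
  have "(\<lambda>X. - (- X)) |`| left_opts G = (\<lambda>X. X) |`| left_opts G"
    "(\<lambda>X. - (- X)) |`| right_opts G = (\<lambda>X. X) |`| right_opts G"
    by (intro fset.map_cong0 options; assumption)+
  then show ?case
    by (intro game.expand) (simp add: fset.map_comp comp_def)
qed

lemma uminus_zero_game [simp]: "- 0 = (0 :: game)"
  by (simp add: zero_game_def)

lemma uminus_game_plus: "- (G + H) = - G + - (H :: game)"
proof (induction "size G + size H" arbitrary: G H rule: less_induct)
  case less
  show ?case
    by (rule game.expand)
       (auto simp: left_opts_plus right_opts_plus fimage_funion fset.map_comp comp_def
         intro!: arg_cong2[of _ _ _ _ funion] fset.map_cong0 less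
         dest: size_left_option size_right_option)
qed

section \<open>Outcomes of negatives and sums\<close>

lemma left_wins_uminus:
  "left_wins_first (- G) \<longleftrightarrow> \<not> left_wins_second G"
  "left_wins_second (- G) \<longleftrightarrow> \<not> left_wins_first G"
proof (induction G rule: game_option_induct)
  case (options G)
  show "left_wins_first (- G) \<longleftrightarrow> \<not> left_wins_second G"
    using options by (simp add: left_wins_first.simps[of "- G"] left_wins_second.simps[of G])
  show "left_wins_second (- G) \<longleftrightarrow> \<not> left_wins_first G"
    using options by (simp add: left_wins_second.simps[of "- G"] left_wins_first.simps[of G])
qed

text \<open>Left answers every move of Right in the component where it was made. A move of Right in
  a component that Left wins moving second leaves one that Left wins moving first, so each claim
  calls on the other and both go through one induction.\<close>

lemma left_wins_plus:
  "left_wins_second G \<Longrightarrow> left_wins_second H \<Longrightarrow> left_wins_second (G + H)"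
  "left_wins_first G \<Longrightarrow> left_wins_second H \<Longrightarrow> left_wins_first (G + H)"
proof (induction "size G + size H" arbitrary: G H rule: less_induct)
  case less
  {
    case 1
    have "left_wins_first (X + H)" if "X |\<in>| right_opts G" for X
      using that 1 less(2)[of X H] size_right_option[of X G] by (auto simp: left_wins_second.simps[of G])
    moreover have "left_wins_first (G + X)" if "X |\<in>| right_opts H" for X
      using that 1 less(2)[of X G] size_right_option[of X H]
      by (auto simp: left_wins_second.simps[of H] add.commute)
    ultimately show ?case
      by (auto simp: left_wins_second.simps[of "G + H"] right_opts_plus)
  next
    case 2
    then obtain X where "X |\<in>| left_opts G" "left_wins_second X"
      by (auto simp: left_wins_first.simps[of G])
    then show ?case
      using 2 less(1)[of X H] size_left_option[of X G]
      by (auto simp: left_wins_first.simps[of "G + H"] left_opts_plus)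
  }
qed

text \<open>The mirror strategy: Left answers a move of Right in one component by its negative in
  the other.\<close>

lemma left_wins_second_diff_self: "left_wins_second (G + - G)"
proof (induction G rule: game_option_induct)
  case (options G)
  have "left_wins_first (X + - G)" if "X |\<in>| right_opts G" for X
    using that options by (auto simp: left_wins_first.simps[of "X + - G"] left_opts_plus)
  moreover have "left_wins_first (G + - X)" if "X |\<in>| left_opts G" for X
    using that options by (auto simp: left_wins_first.simps[of "G + - X"] left_opts_plus)
  ultimately show ?case
    by (auto simp: left_wins_second.simps[of "G + - G"] right_opts_plus)
qed

text \<open>If Left did not win \<open>X\<close>, Left would win \<open>- X\<close> with the other
  player starting. Adding \<open>G + - G\<close> keeps that win, and negating the sum contradicts
  the assumption.\<close>

lemma left_wins_cancel:
  "left_wins_second (X + (G + - G)) \<Longrightarrow> left_wins_second X"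
  "left_wins_first (X + (G + - G)) \<Longrightarrow> left_wins_first X"
  using left_wins_plus[of "- X" "G + - G"] left_wins_second_diff_self[of G]
    left_wins_uminus[of X] left_wins_uminus[of "X + (G + - G)"]
  by (auto simp: uminus_game_plus add.commute)

text \<open>Reduces all contexts to a single game. In one direction the context is
  \<open>- G\<close>. In the other, adding \<open>H + - G\<close> to \<open>G + X\<close> gives
  \<open>H + X\<close> together with a copy of \<open>G + - G\<close>, which cancels.\<close>

lemma game_le_iff_left_wins: "G \<lesssim> H \<longleftrightarrow> left_wins_second (H + - G)"
proof
  assume "G \<lesssim> H"
  then show "left_wins_second (H + - G)"
    using left_wins_second_diff_self[of G] by (auto simp: game_le_def)
next
  assume *: "left_wins_second (H + - G)"
  show "G \<lesssim> H"
    unfolding game_le_def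
    using left_wins_plus[OF _ *, of "G + X" for X] left_wins_cancel[of "H + X" G for X]
    by (simp add: add_ac)
qed

lemma not_game_le_iff: "\<not> G \<lesssim> H \<longleftrightarrow> left_wins_first (G + - H)"
  using left_wins_uminus[of "H + - G"] by (auto simp: game_le_iff_left_wins uminus_game_plus add.commute)

text \<open>Conway's recursive order: in \<open>H + - G\<close> Right moves to a Right option of
  \<open>H\<close> or to the negative of a Left option of \<open>G\<close>, and after each such move
  Left has to win moving first. The rule \<open>game_leI\<close> derived from it carries most later
  comparisons of explicit forms.\<close>

lemma game_le_unfold:
  "G \<lesssim> H \<longleftrightarrow> (\<forall>X. X |\<in>| left_opts G \<longrightarrow> \<not> H \<lesssim> X) \<and> (\<forall>Y. Y |\<in>| right_opts H \<longrightarrow> \<not> Y \<lesssim> G)"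
  unfolding not_game_le_iff
  by (subst game_le_iff_left_wins, subst left_wins_second.simps) (auto simp: right_opts_plus)

lemma game_le_refl [simp]: "G \<lesssim> G"
  by (simp add: game_le_def)

lemma game_le_trans [trans]: "G \<lesssim> H \<Longrightarrow> H \<lesssim> J \<Longrightarrow> G \<lesssim> J"
  by (auto simp: game_le_def)

lemma game_le_uminus_iff [simp]: "- G \<lesssim> - H \<longleftrightarrow> H \<lesssim> G"
  by (simp add: game_le_iff_left_wins add.commute)

lemma game_le_add_right: "G \<lesssim> H \<Longrightarrow> G + X \<lesssim> H + X"
  by (simp add: game_le_def add.assoc)

lemma game_le_add: "G \<lesssim> H \<Longrightarrow> G' \<lesssim> H' \<Longrightarrow> G + G' \<lesssim> H + H'"
  by (metis game_le_add_right game_le_trans add.commute)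

lemma game_le_left_option: "X |\<in>| left_opts G \<Longrightarrow> \<not> G \<lesssim> X"
  and game_le_right_option: "X |\<in>| right_opts G \<Longrightarrow> \<not> X \<lesssim> G"
  using game_le_unfold[of G G] by auto

lemma game_eq_refl [simp]: "G \<approx> G"
  and game_eq_sym: "G \<approx> H \<Longrightarrow> H \<approx> G"
  and game_eq_trans [trans]: "G \<approx> H \<Longrightarrow> H \<approx> J \<Longrightarrow> G \<approx> J"
  and game_eq_add: "G \<approx> H \<Longrightarrow> G' \<approx> H' \<Longrightarrow> G + G' \<approx> H + H'"
  and game_eq_uminus_iff [simp]: "- G \<approx> - H \<longleftrightarrow> G \<approx> H"
  by (auto simp: game_eq_def intro: game_le_trans game_le_add)

lemma game_eq_le_cong: "G \<approx> G' \<Longrightarrow> H \<approx> H' \<Longrightarrow> G \<lesssim> H \<longleftrightarrow> G' \<lesssim> H'"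
  unfolding game_eq_def by (blast intro: game_le_trans)

lemma game_diff_self: "G + - G \<approx> 0"
proof -
  have "0 \<lesssim> G + - G" for G :: game
    unfolding game_le_iff_left_wins using left_wins_second_diff_self by simp
  from this this[of "- G"] game_le_uminus_iff[of "G + - G" 0] show ?thesis
    by (simp add: game_eq_def uminus_game_plus add.commute)
qed

lemma game_add_diff_cancel: "G + X + - X \<approx> G"
  using game_eq_add[OF game_eq_refl[of G] game_diff_self[of X]] by (simp add: add.assoc)

lemma game_le_add_right_iff [simp]: "G + X \<lesssim> H + X \<longleftrightarrow> G \<lesssim> H"
  using game_le_add_right[of G H X] game_le_add_right[of "G + X" "H + X" "- X"]
    game_eq_le_cong[OF game_add_diff_cancel[of G X] game_add_diff_cancel[of H X]] by blast

lemma game_le_diff_iff: "G + X \<lesssim> H \<longleftrightarrow> G \<lesssim> H + - X"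
  using game_le_add_right_iff[of "G + X" "- X" H]
    game_eq_le_cong[OF game_add_diff_cancel[of G X] game_eq_refl[of "H + - X"]] by blast

subsection \<open>Canonical forms and birthdays\<close>

lemma game_leI:
  assumes "\<And>X. X |\<in>| left_opts G \<Longrightarrow> \<not> H \<lesssim> X" "\<And>Y. Y |\<in>| right_opts H \<Longrightarrow> \<not> Y \<lesssim> G"
  shows "G \<lesssim> H"
  using assms by (subst game_le_unfold) blast

lemma not_game_le_left:
  assumes "X |\<in>| left_opts H" "Y \<lesssim> X"
  shows "\<not> H \<lesssim> Y"
  using assms game_le_left_option game_le_trans by blast

lemma not_game_le_right:
  assumes "X |\<in>| right_opts H" "X \<lesssim> Y"
  shows "\<not> Y \<lesssim> H"
  using assms game_le_right_option game_le_trans by blast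

lemma size_game_eq:
  "size G = (\<Sum>X\<in>fset (left_opts G). Suc (size X)) + (\<Sum>X\<in>fset (right_opts G). Suc (size X)) + 1"
  by (cases G) simp

lemma size_uminus_game [simp]: "size (- G :: game) = size G"
proof (induction G rule: game_option_induct)
  case (options G)
  have "inj_on (uminus :: game \<Rightarrow> game) A" for A
    by (metis inj_onI uminus_uminus_game)
  with options show ?case
    by (simp add: size_game_eq[of "- G"] size_game_eq[of G] sum.reindex del: sum.cong)
qed

lemma height_le_iff:
  "height G \<le> n \<longleftrightarrow>
    (\<forall>X. X |\<in>| left_opts G \<longrightarrow> height X < n) \<and> (\<forall>X. X |\<in>| right_opts G \<longrightarrow> height X < n)"
  by (cases G) (auto simp: Suc_le_eq)

lemma height_option:
  "X |\<in>| left_opts G \<Longrightarrow> height X < height G"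
  "X |\<in>| right_opts G \<Longrightarrow> height X < height G"
  using height_le_iff[of G "height G"] by auto

lemma height_plus_le: "height (G + H) \<le> height G + height H"
proof (induction "size G + size H" arbitrary: G H rule: less_induct)
  case less
  have "height (X + H) < height G + height H" if "X |\<in>| left_opts G \<or> X |\<in>| right_opts G" for X
    using less[of X H] that height_option[of X G] size_left_option[of X G] size_right_option[of X G]
    by force
  moreover
  have "height (G + X) < height G + height H" if "X |\<in>| left_opts H \<or> X |\<in>| right_opts H" for X
    using less[of G X] that height_option[of X H] size_left_option[of X H] size_right_option[of X H]
    by force
  ultimately show ?case
    by (auto simp: height_le_iff[of "G + H"] left_opts_plus right_opts_plus)
qed

lemma height_uminus [simp]: "height (- G) = height G"
proof -
  have *: "height (- G) \<le> height G" for G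
  proof (induction G rule: game_option_induct)
    case (options G)
    then show ?case
      unfolding height_le_iff[of "- G"]
      by (auto intro: le_less_trans[OF options(1)] le_less_trans[OF options(2)] height_option)
  qed
  from *[of G] *[of "- G"] show ?thesis
    by simp
qed

text \<open>Minimality takes the place of a terminating simplification procedure: an option that
  could be deleted or bypassed would yield a smaller form. Competitors are limited to forms of no
  greater height, so that every game has an equal minimal form that is not higher; this later bounds
  the birthday by the height of any form.\<close>

definition minimal_form :: "game \<Rightarrow> bool" where
  "minimal_form G \<longleftrightarrow> (\<forall>K. K \<approx> G \<longrightarrow> height K \<le> height G \<longrightarrow> size G \<le> size K)"

lemma minimal_form_exists: "\<exists>K. minimal_form K \<and> K \<approx> G \<and> height K \<le> height G"
proof -
  define P where "P K \<longleftrightarrow> K \<approx> G \<and> height K \<le> height G" for K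
  have "P G"
    by (simp add: P_def)
  then obtain K where K: "P K" "\<And>K'. P K' \<Longrightarrow> size K \<le> size K'"
    by (metis arg_min_natI arg_min_nat_le)
  then have "minimal_form K"
    unfolding minimal_form_def P_def by (meson game_eq_trans le_trans)
  with K show ?thesis
    by (auto simp: P_def)
qed

lemma minimal_form_uminus: "minimal_form G \<Longrightarrow> minimal_form (- G)"
  unfolding minimal_form_def
  by (metis game_eq_uminus_iff height_uminus size_uminus_game uminus_uminus_game)

text \<open>The common core of three simplifications: \<open>S\<close> is empty for a dominated
  option, consists of the Left options of \<open>Y\<close> for an option reversible through
  \<open>Y\<close>, and is one smaller equal form when \<open>X\<close> itself is not minimal. The
  weight \<open>Suc (size Y)\<close> is what an option contributes to the size of its
  parent.\<close>

lemma minimal_form_replace: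
  fixes S :: "game fset"
  assumes "minimal_form G" and X: "X |\<in>| left_opts G"
    and "(\<Sum>Y\<in>fset S. Suc (size Y)) \<le> size X" and "\<And>Y. Y |\<in>| S \<Longrightarrow> height Y < height G"
  shows "\<not> Game ((left_opts G |-| {|X|}) |\<union>| S) (right_opts G) \<approx> G"
proof
  define L where "L = fset (left_opts G)"
  define G' where "G' = Game ((left_opts G |-| {|X|}) |\<union>| S) (right_opts G)"
  assume "Game ((left_opts G |-| {|X|}) |\<union>| S) (right_opts G) \<approx> G"
  moreover have "height G' \<le> height G"
    using assms by (auto simp: height_le_iff[of G'] G'_def Suc_le_eq intro: height_option)
  ultimately have "size G \<le> size G'"
    using assms by (auto simp: minimal_form_def G'_def)
  moreover have "size G' < size G"
  proof -
    have "finite L"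
      by (simp add: L_def)
    \<comment> \<open>Only an inequality, because \<open>S\<close> may share members with the
      remaining options.\<close>
    have "(\<Sum>Y\<in>(L - {X}) \<union> fset S. Suc (size Y)) \<le>
        (\<Sum>Y\<in>L - {X}. Suc (size Y)) + (\<Sum>Y\<in>fset S. Suc (size Y))"
      using sum.union_inter[of "L - {X}" "fset S" "\<lambda>Y. Suc (size Y)"] \<open>finite L\<close> by simp
    also have "\<dots> < (\<Sum>Y\<in>L - {X}. Suc (size Y)) + Suc (size X)"
      using assms by simp
    also have "\<dots> = (\<Sum>Y\<in>L. Suc (size Y))"
      using X sum.remove[of L X "\<lambda>Y. Suc (size Y)"] by (simp add: L_def)
    finally show ?thesis
      by (simp add: size_game_eq[of G'] size_game_eq[of G] G'_def L_def minus_fset)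
  qed
  ultimately show False
    by simp
qed

lemma minimal_form_not_dominated:
  assumes "minimal_form G" "X |\<in>| left_opts G" "Y |\<in>| left_opts G" "X \<lesssim> Y"
  shows "X = Y"
proof (rule ccontr)
  assume "X \<noteq> Y"
  define G' where "G' = Game ((left_opts G |-| {|X|}) |\<union>| {||}) (right_opts G)"
  then have G': "left_opts G' = left_opts G |-| {|X|}" "right_opts G' = right_opts G"
    by simp_all
  have "G' \<lesssim> G"
    by (rule game_leI) (auto simp: G' game_le_left_option game_le_right_option)
  moreover have "G \<lesssim> G'"
  proof (rule game_leI)
    fix Z assume "Z |\<in>| left_opts G"
    then show "\<not> G' \<lesssim> Z"
      using not_game_le_left[of Y G' Z] not_game_le_left[of Z G' Z] assms \<open>X \<noteq> Y\<close>
      by (cases "Z = X") (auto simp: G')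
  qed (auto simp: G' game_le_right_option)
  ultimately show False
    using minimal_form_replace[of G X "{||}"] assms by (simp add: G'_def game_eq_def)
qed

lemma minimal_form_not_reversible:
  assumes "minimal_form G" and X: "X |\<in>| left_opts G" and Y: "Y |\<in>| right_opts X"
  shows "\<not> Y \<lesssim> G"
proof
  assume "Y \<lesssim> G"
  define G' where "G' = Game ((left_opts G |-| {|X|}) |\<union>| left_opts Y) (right_opts G)"
  then have G': "left_opts G' = (left_opts G |-| {|X|}) |\<union>| left_opts Y" "right_opts G' = right_opts G"
    by simp_all
  \<comment> \<open>This takes care of the removed option: \<open>G' \<lesssim> X\<close> would give
    \<open>Y \<lesssim> X\<close>, although \<open>Y\<close> is a Right option of
    \<open>X\<close>.\<close>
  have "Y \<lesssim> G'"
  proof (rule game_leI)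
    show "\<not> G' \<lesssim> Z" if "Z |\<in>| left_opts Y" for Z
      using that by (simp add: G' game_le_left_option)
    show "\<not> Z \<lesssim> Y" if "Z |\<in>| right_opts G'" for Z
      using that \<open>Y \<lesssim> G\<close> G' game_le_right_option game_le_trans by metis
  qed
  have "G' \<lesssim> G"
  proof (rule game_leI)
    show "\<not> G \<lesssim> Z" if "Z |\<in>| left_opts G'" for Z
      using that \<open>Y \<lesssim> G\<close> game_le_left_option[of Z G] game_le_left_option[of Z Y]
      by (auto simp: G' dest: game_le_trans)
    show "\<not> Z \<lesssim> G'" if "Z |\<in>| right_opts G" for Z
      using that by (simp add: G' game_le_right_option)
  qed
  moreover have "G \<lesssim> G'"
  proof (rule game_leI)
    fix Z assume Z: "Z |\<in>| left_opts G"
    show "\<not> G' \<lesssim> Z"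
    proof (cases "Z = X")
      case True
      with \<open>Y \<lesssim> G'\<close> Y show ?thesis
        using not_game_le_right by (metis game_le_trans game_le_right_option)
    next
      case False
      with Z show ?thesis
        by (intro game_le_left_option) (auto simp: G')
    qed
  qed (auto simp: G' game_le_right_option)
  moreover have "(\<Sum>Z\<in>fset (left_opts Y). Suc (size Z)) \<le> size X"
    using size_game_eq[of Y] size_right_option[OF Y] by simp
  moreover have "height Z < height G" if "Z |\<in>| left_opts Y" for Z
    using height_option X Y that by (meson less_trans)
  ultimately show False
    using minimal_form_replace[of G X "left_opts Y"] assms by (auto simp: G'_def game_eq_def)
qed

lemma minimal_form_left_option:
  assumes "minimal_form G" and X: "X |\<in>| left_opts G"
  shows "minimal_form X"
proof (rule ccontr)
  assume "\<not> minimal_form X"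
  then obtain X' where X': "X' \<approx> X" "height X' \<le> height X" "size X' < size X"
    by (auto simp: minimal_form_def not_le)
  define G' where "G' = Game ((left_opts G |-| {|X|}) |\<union>| {|X'|}) (right_opts G)"
  then have G': "left_opts G' = (left_opts G |-| {|X|}) |\<union>| {|X'|}" "right_opts G' = right_opts G"
    by simp_all
  have "G' \<lesssim> G"
  proof (rule game_leI)
    show "\<not> G \<lesssim> Z" if "Z |\<in>| left_opts G'" for Z
      using that not_game_le_left[OF X, of Z] X'(1)
      by (auto simp: G' game_eq_def game_le_left_option)
    show "\<not> Z \<lesssim> G'" if "Z |\<in>| right_opts G" for Z
      using that by (simp add: G' game_le_right_option)
  qed
  moreover have "G \<lesssim> G'"
  proof (rule game_leI)
    fix Z assume "Z |\<in>| left_opts G"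
    then show "\<not> G' \<lesssim> Z"
      using not_game_le_left[of X' G' Z] not_game_le_left[of Z G' Z] X'
      by (cases "Z = X") (auto simp: G' game_eq_def)
  qed (auto simp: G' game_le_right_option)
  ultimately show False
    using minimal_form_replace[of G X "{|X'|}"] assms X' height_option(1)[OF X]
    by (auto simp: G'_def game_eq_def)
qed

text \<open>Right options of \<open>G\<close> are negatives of Left options of \<open>- G\<close>,
  and \<open>- G\<close> is minimal too, so the preceding lemmas about Left options cover both
  sides.\<close>

lemma minimal_form_canonical: "minimal_form G \<Longrightarrow> canonical G"
proof (induction G rule: game_option_induct)
  case (options G)
  note neg = minimal_form_uminus[OF \<open>minimal_form G\<close>]
  have R: "- X |\<in>| left_opts (- G)" if "X |\<in>| right_opts G" for X
    using that by simp
  show ?case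
  proof
    show "\<not> has_dominated_option G"
      unfolding has_dominated_option_def
      using minimal_form_not_dominated[OF \<open>minimal_form G\<close>] minimal_form_not_dominated[OF neg R R]
      by (metis game_le_uminus_iff uminus_uminus_game)
    show "\<not> has_reversible_option G"
    proof -
      have "\<not> G \<lesssim> Y" if "X |\<in>| right_opts G" "Y |\<in>| left_opts X" for X Y
        using minimal_form_not_reversible[OF neg R, of X "- Y"] that by simp
      then show ?thesis
        unfolding has_reversible_option_def
        using minimal_form_not_reversible[OF \<open>minimal_form G\<close>] by blast
    qed
    show "canonical X" if "X |\<in>| left_opts G" for X
      using options that minimal_form_left_option by blast
    show "canonical X" if "X |\<in>| right_opts G" for X
      using options that minimal_form_uminus[OF minimal_form_left_option[OF neg R]] by simp
  qed
qed

text \<open>A Left option of \<open>K\<close> is bounded by one of \<open>K'\<close>, which is in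
  turn bounded by one of \<open>K\<close>. Without dominated options this chain closes up, so the
  two options are equal in value and, by induction, identical. Right options behave dually.\<close>

lemma canonical_unique: "canonical K \<Longrightarrow> canonical K' \<Longrightarrow> K \<approx> K' \<Longrightarrow> K = K'"
proof (induction K arbitrary: K' rule: game_option_induct)
  case (options K)
  \<comment> \<open>Since \<open>\<not> H \<lesssim> X\<close>, either some Left option of
    \<open>H\<close> is at least \<open>X\<close>, or some Right option of \<open>X\<close> is at
    most \<open>H\<close>; the latter would make \<open>X\<close> reversible in
    \<open>G\<close>.\<close>
  have left: "\<exists>Y. Y |\<in>| left_opts H \<and> X \<lesssim> Y"
    if "canonical G" "G \<approx> H" "X |\<in>| left_opts G" for G H X
  proof -
    have "\<not> H \<lesssim> X"
      using that not_game_le_left by (metis game_eq_def game_le_trans game_le_refl)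
    moreover have "\<not> Y \<lesssim> H" if "Y |\<in>| right_opts X" for Y
      using that \<open>X |\<in>| left_opts G\<close> \<open>canonical G\<close> \<open>G \<approx> H\<close>
      by (auto simp: canonical.simps[of G] has_reversible_option_def game_eq_def dest: game_le_trans)
    ultimately show ?thesis
      by (subst (asm) game_le_unfold) blast
  qed
  have right: "\<exists>Y. Y |\<in>| right_opts H \<and> Y \<lesssim> X"
    if "canonical G" "G \<approx> H" "X |\<in>| right_opts G" for G H X
  proof -
    have "\<not> X \<lesssim> H"
      using that not_game_le_right by (metis game_eq_def game_le_trans game_le_refl)
    moreover have "\<not> H \<lesssim> Y" if "Y |\<in>| left_opts X" for Y
      using that \<open>X |\<in>| right_opts G\<close> \<open>canonical G\<close> \<open>G \<approx> H\<close>
      by (auto simp: canonical.simps[of G] has_reversible_option_def game_eq_def dest: game_le_trans)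
    ultimately show ?thesis
      by (subst (asm) game_le_unfold) blast
  qed
  have left_eq: "X = Y"
    if "canonical G" "X |\<in>| left_opts G" "Y |\<in>| left_opts G" "X \<lesssim> Y" for G X Y
    using that by (auto simp: canonical.simps[of G] has_dominated_option_def)
  have right_eq: "X = Y"
    if "canonical G" "X |\<in>| right_opts G" "Y |\<in>| right_opts G" "X \<lesssim> Y" for G X Y
    using that by (auto simp: canonical.simps[of G] has_dominated_option_def)
  have can: "canonical X" if "canonical G" "X |\<in>| left_opts G \<or> X |\<in>| right_opts G" for G X
    using that by (auto simp: canonical.simps[of G])
  note sym = game_eq_sym[OF \<open>K \<approx> K'\<close>]
  show ?case
  proof (rule game.expand, intro conjI fset_eqI iffI)
    fix X assume X: "X |\<in>| left_opts K"
    then obtain Y Z where "Y |\<in>| left_opts K'" "X \<lesssim> Y" "Z |\<in>| left_opts K" "Y \<lesssim> Z"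
      using left options sym by metis
    moreover from this X have "X = Z"
      using left_eq options.prems(1) by (metis game_le_trans)
    ultimately show "X |\<in>| left_opts K'"
      using options X can unfolding game_eq_def by metis
  next
    fix X assume X: "X |\<in>| left_opts K'"
    then obtain Y Z where "Y |\<in>| left_opts K" "X \<lesssim> Y" "Z |\<in>| left_opts K'" "Y \<lesssim> Z"
      using left options sym by metis
    moreover from this X have "X = Z"
      using left_eq options.prems(2) by (metis game_le_trans)
    ultimately show "X |\<in>| left_opts K"
      using options X can unfolding game_eq_def by metis
  next
    fix X assume X: "X |\<in>| right_opts K"
    then obtain Y Z where "Y |\<in>| right_opts K'" "Y \<lesssim> X" "Z |\<in>| right_opts K" "Z \<lesssim> Y"
      using right options sym by metis
    moreover from this X have "X = Z"
      using right_eq options.prems(1) by (metis game_le_trans)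
    ultimately show "X |\<in>| right_opts K'"
      using options X can unfolding game_eq_def by metis
  next
    fix X assume X: "X |\<in>| right_opts K'"
    then obtain Y Z where "Y |\<in>| right_opts K" "Y \<lesssim> X" "Z |\<in>| right_opts K'" "Z \<lesssim> Y"
      using right options sym by metis
    moreover from this X have "X = Z"
      using right_eq options.prems(2) by (metis game_le_trans)
    ultimately show "X |\<in>| right_opts K"
      using options X can unfolding game_eq_def by metis
  qed
qed

section \<open>The birthday as an invariant of the value\<close>

lemma canonical_form_eqI: "canonical K \<Longrightarrow> K \<approx> G \<Longrightarrow> canonical_form G = K"
  unfolding canonical_form_def
  by (rule the_equality) (auto intro: canonical_unique game_eq_trans game_eq_sym)

lemma canonical_form_eq: "canonical_form G \<approx> G"
  and birthday_le_height: "birthday G \<le> height G"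
proof -
  obtain K where "minimal_form K" "K \<approx> G" "height K \<le> height G"
    using minimal_form_exists by blast
  moreover from this have "canonical_form G = K"
    by (intro canonical_form_eqI minimal_form_canonical)
  ultimately show "canonical_form G \<approx> G" "birthday G \<le> height G"
    by (auto simp: birthday_def)
qed

lemma birthday_cong:
  assumes "G \<approx> H"
  shows "birthday G = birthday H"
proof -
  obtain K where "minimal_form K" "K \<approx> G"
    using minimal_form_exists by blast
  then have "canonical_form G = K" "canonical_form H = K"
    using assms by (auto intro: canonical_form_eqI minimal_form_canonical game_eq_trans)
  then show ?thesis
    by (simp add: birthday_def)
qed

lemma birthday_plus_le: "birthday (G + H) \<le> birthday G + birthday H"
proof -
  have "birthday (G + H) = birthday (canonical_form G + canonical_form H)"
    by (intro birthday_cong game_eq_add game_eq_sym[OF canonical_form_eq])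
  also have "\<dots> \<le> birthday G + birthday H"
    unfolding birthday_def[of G] birthday_def[of H]
    by (rule order.trans[OF birthday_le_height height_plus_le])
  finally show ?thesis .
qed

subsection \<open>Dyadic rationals\<close>

lemma game_eq_cancel: "G + X \<approx> H + X \<longleftrightarrow> G \<approx> H"
  by (simp add: game_eq_def)

lemma dyadic_game_0 [simp]: "dyadic_game 0 k = 0"
  by (induction k) (simp_all add: int_game_def)

lemma dyadic_game_even: "dyadic_game (2 * m) (Suc k) = dyadic_game m k"
  by simp

lemma dyadic_game_odd:
  "dyadic_game (2 * m + 1) (Suc k) = Game {|dyadic_game m k|} {|dyadic_game (m + 1) k|}"
  by (simp add: add.commute)

text \<open>An even numerator is resolved to the very form one level down, so expanding a fraction
  leaves the form identical, not merely equal in value. This is what permits common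
  denominators.\<close>

lemma dyadic_game_scale: "dyadic_game (m * 2 ^ j) (k + j) = dyadic_game m k"
proof (induction j)
  case (Suc j)
  then show ?case
    using dyadic_game_even[of "m * 2 ^ j" "k + j"] by (simp add: mult_ac del: dyadic_game.simps)
qed simp

lemma uminus_dyadic_game: "- dyadic_game m k = dyadic_game (- m) k"
proof (induction k arbitrary: m)
  case 0
  then show ?case
    by (auto simp: int_game_def)
next
  case (Suc k)
  show ?case
  proof (cases "even m")
    case True
    then obtain a where "m = 2 * a" ..
    then show ?thesis
      using Suc[of a] dyadic_game_even[of "- a" k] by simp
  next
    case False
    then obtain a where m: "m = 2 * a + 1" by (rule oddE)
    have "- m = 2 * (- (a + 1)) + 1"
      using m by simp
    then have "dyadic_game (- m) (Suc k) = Game {|dyadic_game (- (a + 1)) k|} {|dyadic_game (- a) k|}"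
      using dyadic_game_odd[of "- (a + 1)" k] by (simp del: dyadic_game.simps)
    then show ?thesis
      unfolding m dyadic_game_odd by (simp add: Suc del: dyadic_game.simps)
  qed
qed

lemma left_opts_int_game: "left_opts (int_game m) = (if 0 < m then {|int_game (m - 1)|} else {||})"
  and right_opts_int_game: "right_opts (int_game m) = (if m < 0 then {|int_game (m + 1)|} else {||})"
proof -
  have pos: "left_opts (int_game m) = (if 0 < m then {|int_game (m - 1)|} else {||}) \<and>
      right_opts (int_game m) = {||}" if "0 \<le> m" for m
    using that
  proof (cases m rule: int_cases2)
    case (nonneg n)
    then show ?thesis
      by (cases n) (simp_all add: int_game_def nat_add_distrib)
  qed (auto simp: int_game_def)
  have neg: "int_game m = - int_game (- m)" for m
    using uminus_dyadic_game[of "- m" 0] by simp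
  show "left_opts (int_game m) = (if 0 < m then {|int_game (m - 1)|} else {||})"
    using pos[of m] pos[of "- m"] neg[of m] by (cases "0 \<le> m") simp_all
  show "right_opts (int_game m) = (if m < 0 then {|int_game (m + 1)|} else {||})"
  proof (cases "0 \<le> m")
    case False
    then have "right_opts (int_game m) = {|- int_game (- m - 1)|}"
      using pos[of "- m"] neg[of m] by simp
    also have "- int_game (- m - 1) = int_game (m + 1)"
      using neg[of "m + 1"] by simp
    finally show ?thesis
      using False by simp
  qed (use pos[of m] in simp)
qed

lemma nat_game_le_Suc: "nat_game n \<lesssim> nat_game (Suc n)"
proof (induction n)
  case (Suc n)
  then show ?case
    using not_game_le_left[of "nat_game (Suc n)" "nat_game (Suc (Suc n))"] by (intro game_leI) simp_all
qed (intro game_leI, simp_all)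

lemma int_game_le_add_1: "int_game m \<lesssim> int_game (m + 1)"
proof (cases "0 \<le> m")
  case True
  then show ?thesis
    using nat_game_le_Suc[of "nat m"] by (simp add: int_game_def nat_add_distrib)
next
  case False
  define n where "n = nat (- (m + 1))"
  have "int_game m = - nat_game (Suc n)" "int_game (m + 1) = - nat_game n"
    using False by (auto simp: int_game_def n_def Suc_nat_eq_nat_zadd1)
  then show ?thesis
    using nat_game_le_Suc[of n] by (simp only: game_le_uminus_iff)
qed

text \<open>The last two claims, that options lie at least one unit \<open>1 / 2 ^ k\<close> away,
  strengthen the induction. Level \<open>Suc k\<close> is level \<open>k\<close> with a new number
  \<open>Q a\<close> inserted between neighbours; as the options of those neighbours are a full old
  unit away, they do not obstruct the comparison with \<open>Q a\<close>.\<close>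

lemma dyadic_game_step:
  "dyadic_game m k \<lesssim> dyadic_game (m + 1) k" (is "?le m k")
  "\<not> dyadic_game (m + 1) k \<lesssim> dyadic_game m k" (is "?less m k")
  "X |\<in>| left_opts (dyadic_game m k) \<Longrightarrow> X \<lesssim> dyadic_game (m - 1) k"
  "Y |\<in>| right_opts (dyadic_game m k) \<Longrightarrow> dyadic_game (m + 1) k \<lesssim> Y"
proof (induction k arbitrary: m X Y)
  case 0
  {
    case 1
    show ?case
      using int_game_le_add_1 by simp
  next
    case 2
    show ?case
      using game_le_left_option[of "int_game m" "int_game (m + 1)"]
        game_le_right_option[of "int_game (m + 1)" "int_game m"]
      by (cases "0 \<le> m") (simp_all add: left_opts_int_game right_opts_int_game)
  next
    case 3
    then show ?case
      by (simp add: left_opts_int_game split: if_splits)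
  next
    case 4
    then show ?case
      by (simp add: right_opts_int_game split: if_splits)
  }
next
  case (Suc k)
  define Q where "Q a = dyadic_game (2 * a + 1) (Suc k)" for a
  have L: "left_opts (Q a) = {|dyadic_game a k|}" and R: "right_opts (Q a) = {|dyadic_game (a + 1) k|}" for a
    unfolding Q_def dyadic_game_odd by simp_all
  have Q1: "dyadic_game a k \<lesssim> Q a" for a
  proof (rule game_leI)
    show "\<not> Q a \<lesssim> X" if "X |\<in>| left_opts (dyadic_game a k)" for X
      using that Suc(3) Suc(1)[of "a - 1"]
      by (intro not_game_le_left[of "dyadic_game a k"]) (auto simp: L intro: game_le_trans)
    show "\<not> Y \<lesssim> dyadic_game a k" if "Y |\<in>| right_opts (Q a)" for Y
      using that Suc(2) by (simp add: R)
  qed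
  have Q2: "Q a \<lesssim> dyadic_game (a + 1) k" for a
  proof (rule game_leI)
    show "\<not> dyadic_game (a + 1) k \<lesssim> X" if "X |\<in>| left_opts (Q a)" for X
      using that Suc(2) by (simp add: L)
    show "\<not> Y \<lesssim> Q a" if "Y |\<in>| right_opts (dyadic_game (a + 1) k)" for Y
      using Suc(4)[OF that] Suc(1)[of "a + 1"]
      by (intro not_game_le_right[of "dyadic_game (a + 1) k"]) (auto simp: R intro: game_le_trans)
  qed
  have Q3: "\<not> Q a \<lesssim> dyadic_game a k" "\<not> dyadic_game (a + 1) k \<lesssim> Q a" for a
    by (simp_all add: game_le_left_option game_le_right_option L R)
  have even: "dyadic_game (2 * a) (Suc k) = dyadic_game a k" for a
    by simp
  have step: "?le m (Suc k) \<and> ?less m (Suc k)" for m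
  proof (cases "even m")
    case True
    then obtain a where "m = 2 * a" ..
    then show ?thesis
      using Q1[of a] Q3[of a] unfolding Q_def by (simp only: even simp_thms)
  next
    case False
    then obtain a where "m = 2 * a + 1" by (rule oddE)
    moreover from this have "m + 1 = 2 * (a + 1)"
      by simp
    ultimately show ?thesis
      using Q2[of a] Q3[of a] unfolding Q_def by (simp only: even simp_thms)
  qed
  {
    case 1
    show ?case using step by blast
  next
    case 2
    show ?case using step by blast
  next
    case 3
    show ?case
    proof (cases "even m")
      case True
      then obtain a where m: "m = 2 * a" ..
      then have "m - 1 = 2 * (a - 1) + 1"
        by simp
      \<comment> \<open>The form for \<open>m = 2 * a\<close> has the old Left options, which are at
        most \<open>a - 1\<close> in old units and hence below the new
        \<open>Q (a - 1)\<close>.\<close>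
      then show ?thesis
        using 3 Q1[of "a - 1"] Suc(3)[where m = a] unfolding Q_def m
        by (simp only: even) (blast intro: game_le_trans)
    next
      case False
      then obtain a where m: "m = 2 * a + 1" by (rule oddE)
      then have "m - 1 = 2 * a"
        by simp
      with 3 m show ?thesis
        using L[of a] by (simp only: even Q_def) simp
    qed
  next
    case 4
    show ?case
    proof (cases "even m")
      case True
      then obtain a where m: "m = 2 * a" ..
      then show ?thesis
        using 4 Q2[of a] Suc(4)[where m = a] unfolding Q_def m
        by (simp only: even) (blast intro: game_le_trans)
    next
      case False
      then obtain a where m: "m = 2 * a + 1" by (rule oddE)
      then have "m + 1 = 2 * (a + 1)"
        by simp
      with 4 m show ?thesis
        using R[of a] by (simp only: even Q_def) simp
    qed
  }
qed

lemma dyadic_game_le_iff: "dyadic_game m k \<lesssim> dyadic_game n k \<longleftrightarrow> m \<le> n"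
proof -
  have *: "dyadic_game m k \<lesssim> dyadic_game n k" if "m \<le> n" for m n
    using that by (induction n rule: int_ge_induct) (auto intro: game_le_trans dyadic_game_step)
  moreover have "\<not> dyadic_game m k \<lesssim> dyadic_game n k" if "n < m"
    using *[of "n + 1" m] that dyadic_game_step(2)[of n k] by (auto intro: game_le_trans)
  ultimately show ?thesis
    by (meson not_le)
qed

section \<open>Addition of dyadic games\<close>

lemma game_eq_le_right: "X \<approx> Y \<Longrightarrow> Z \<lesssim> X \<longleftrightarrow> Z \<lesssim> Y"
  and game_eq_le_left: "X \<approx> Y \<Longrightarrow> X \<lesssim> Z \<longleftrightarrow> Y \<lesssim> Z"
  by (simp_all add: game_eq_le_cong)

lemma nat_game_add_1: "nat_game n + nat_game 1 \<approx> nat_game (Suc n)"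
proof (induction n)
  case (Suc n)
  have "nat_game (Suc n) + nat_game 1 \<lesssim> nat_game (Suc (Suc n))"
  proof (rule game_leI)
    fix X assume "X |\<in>| left_opts (nat_game (Suc n) + nat_game 1)"
    then have "X \<lesssim> nat_game (Suc n)"
      using Suc by (auto simp: left_opts_plus game_eq_def)
    then show "\<not> nat_game (Suc (Suc n)) \<lesssim> X"
      by (intro not_game_le_left) simp_all
  qed simp
  moreover have "nat_game (Suc (Suc n)) \<lesssim> nat_game (Suc n) + nat_game 1"
    by (rule game_leI) (auto simp: right_opts_plus left_opts_plus intro!: game_le_left_option)
  ultimately show ?case
    by (simp add: game_eq_def)
qed simp

text \<open>In the induction step, \<open>h\<close> is the new unit and \<open>u\<close> the old
  one. The fact \<open>half\<close> settles even numerators. For odd ones, \<open>Q a + h\<close>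
  becomes \<open>dyadic_game a k + h + h\<close>, and \<open>double\<close> with the induction
  hypothesis moves on to the next old number.\<close>

lemma dyadic_game_add_1: "dyadic_game m k + dyadic_game 1 k \<approx> dyadic_game (m + 1) k"
proof (induction k arbitrary: m)
  case 0
  have 1: "int_game 1 = nat_game 1"
    by (simp add: int_game_def)
  show ?case
  proof (cases "0 \<le> m")
    case True
    then show ?thesis
      using nat_game_add_1[of "nat m"] by (simp add: int_game_def nat_add_distrib)
  next
    case False
    define n where "n = nat (- (m + 1))"
    have m: "int_game m = - nat_game (Suc n)" "int_game (m + 1) = - nat_game n"
      using False by (auto simp: int_game_def n_def Suc_nat_eq_nat_zadd1)
    have "- (nat_game n + nat_game 1) \<approx> - nat_game (Suc n)"
      unfolding game_eq_uminus_iff by (rule nat_game_add_1)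
    then have "- nat_game (Suc n) + nat_game 1 \<approx> - (nat_game n + nat_game 1) + nat_game 1"
      unfolding game_eq_cancel by (rule game_eq_sym)
    also have "\<dots> \<approx> - nat_game n"
      using game_add_diff_cancel[of "- nat_game n" "- nat_game 1"] by (simp add: uminus_game_plus)
    finally show ?thesis
      by (simp add: m 1)
  qed
next
  case (Suc k)
  define u h where "u = dyadic_game 1 k" and "h = dyadic_game 1 (Suc k)"
  define Q where "Q a = dyadic_game (2 * a + 1) (Suc k)" for a
  have L: "left_opts (Q a) = {|dyadic_game a k|}" and R: "right_opts (Q a) = {|dyadic_game (a + 1) k|}" for a
    unfolding Q_def dyadic_game_odd by simp_all
  have Lh: "left_opts h = {|0|}" and Rh: "right_opts h = {|u|}"
    using L[of 0] R[of 0] by (simp_all add: Q_def h_def u_def)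
  have h: "0 \<lesssim> h" "\<not> h \<lesssim> 0" "h \<lesssim> u" "\<not> u \<lesssim> h"
    using dyadic_game_le_iff[of 0 "Suc k" 1] dyadic_game_le_iff[of 1 "Suc k" 0]
      dyadic_game_le_iff[of 2 "Suc k" 1] dyadic_game_le_iff[of 1 "Suc k" 2]
    by (simp_all add: u_def h_def)
  have IH: "dyadic_game a k + u \<approx> dyadic_game (a + 1) k" for a
    using Suc by (simp add: u_def)
  have half: "dyadic_game a k + h \<approx> Q a" for a
    unfolding game_eq_def
  proof
    show "dyadic_game a k + h \<lesssim> Q a"
    proof (rule game_leI)
      fix X assume "X |\<in>| left_opts (dyadic_game a k + h)"
      then consider Z where "Z |\<in>| left_opts (dyadic_game a k)" "X = Z + h" | "X = dyadic_game a k"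
        by (auto simp: left_opts_plus Lh)
      \<comment> \<open>Moving in the first summand loses at least one old unit \<open>u\<close>,
        while \<open>h\<close> restores at most \<open>u\<close>.\<close>
      then have "X \<lesssim> dyadic_game a k"
      proof cases
        case 1
        then have "X \<lesssim> dyadic_game (a - 1) k + u"
          using dyadic_game_step(3) h by (auto intro: game_le_add)
        then show ?thesis
          using IH[of "a - 1"] by (auto simp: game_eq_def intro: game_le_trans)
      qed simp
      then show "\<not> Q a \<lesssim> X"
        by (intro not_game_le_left[of "dyadic_game a k"]) (simp_all add: L)
    next
      fix Y assume "Y |\<in>| right_opts (Q a)"
      then have "Y \<lesssim> dyadic_game a k + h \<longleftrightarrow> dyadic_game a k + u \<lesssim> dyadic_game a k + h"
        using IH[of a] by (simp add: R game_eq_le_left)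
      then show "\<not> Y \<lesssim> dyadic_game a k + h"
        using h by (simp add: add.commute[of "dyadic_game a k"])
    qed
    show "Q a \<lesssim> dyadic_game a k + h"
    proof (rule game_leI)
      show "\<not> dyadic_game a k + h \<lesssim> X" if "X |\<in>| left_opts (Q a)" for X
        using that by (intro game_le_left_option) (simp add: L Lh left_opts_plus)
    next
      fix Y assume "Y |\<in>| right_opts (dyadic_game a k + h)"
      then consider Z where "Z |\<in>| right_opts (dyadic_game a k)" "Y = Z + h" | "Y = dyadic_game a k + u"
        by (auto simp: right_opts_plus Rh)
      then have "dyadic_game (a + 1) k \<lesssim> Y"
      proof cases
        case 1
        then have "dyadic_game (a + 1) k + 0 \<lesssim> Z + h"
          using dyadic_game_step(4) h by (intro game_le_add)
        then show ?thesis
          using 1 by simp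
      next
        case 2
        then show ?thesis
          using IH[of a] by (simp add: game_eq_def)
      qed
      then show "\<not> Y \<lesssim> Q a"
        by (intro not_game_le_right[of "dyadic_game (a + 1) k"]) (simp_all add: R)
    qed
  qed
  have double: "h + h \<approx> u"
    unfolding game_eq_def
  proof
    show "h + h \<lesssim> u"
    proof (rule game_leI)
      show "\<not> u \<lesssim> X" if "X |\<in>| left_opts (h + h)" for X
        using that h by (auto simp: left_opts_plus Lh)
    next
      fix Y assume "Y |\<in>| right_opts u"
      then have "dyadic_game (1 + 1) k \<lesssim> Y"
        unfolding u_def by (rule dyadic_game_step)
      then have "u + u \<lesssim> Y"
        using IH[of 1] by (simp add: u_def game_eq_le_left)
      moreover have "h + h \<lesssim> h + u"
        using h by (intro game_le_add) simp_all
      moreover have "\<not> u + u \<lesssim> h + u"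
        using h by simp
      ultimately show "\<not> Y \<lesssim> h + h"
        using game_le_trans by blast
    qed
    show "u \<lesssim> h + h"
    proof (rule game_leI)
      fix X assume "X |\<in>| left_opts u"
      then have "X \<lesssim> 0"
        using dyadic_game_step(3)[of X 1 k] by (simp add: u_def)
      moreover have "0 + h \<lesssim> h + h"
        using h by (intro game_le_add) simp_all
      ultimately show "\<not> h + h \<lesssim> X"
        using h game_le_trans by (metis add_0)
    next
      have "\<not> h + u \<lesssim> 0 + u"
        using h unfolding game_le_add_right_iff by simp
      then show "\<not> Y \<lesssim> u" if "Y |\<in>| right_opts (h + h)" for Y
        using that by (auto simp: right_opts_plus Rh add.commute)
    qed
  qed
  show ?case
  proof (cases "even m")
    case True
    then obtain a where "m = 2 * a" ..
    then show ?thesis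
      using half[of a] unfolding h_def Q_def by (simp only: dyadic_game_even)
  next
    case False
    then obtain a where m: "m = 2 * a + 1" by (rule oddE)
    then have m': "m + 1 = 2 * (a + 1)"
      by simp
    have "Q a + h \<approx> dyadic_game a k + h + h"
      unfolding game_eq_cancel by (rule game_eq_sym[OF half])
    also have "\<dots> = dyadic_game a k + (h + h)"
      by (rule add.assoc)
    also have "\<dots> \<approx> dyadic_game a k + u"
      by (rule game_eq_add[OF game_eq_refl double])
    also have "\<dots> \<approx> dyadic_game (a + 1) k"
      by (rule IH)
    finally show ?thesis
      unfolding m' dyadic_game_even unfolding m Q_def h_def .
  qed
qed

lemma dyadic_game_add: "dyadic_game m k + dyadic_game n k \<approx> dyadic_game (m + n) k"
proof -
  \<comment> \<open>Stated as an equivalence so that it serves the integer induction both upwards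
    and downwards from 0.\<close>
  have step: "dyadic_game m k + dyadic_game (n + 1) k \<approx> dyadic_game (m + (n + 1)) k \<longleftrightarrow>
      dyadic_game m k + dyadic_game n k \<approx> dyadic_game (m + n) k" for n
  proof -
    have 1: "dyadic_game m k + dyadic_game (n + 1) k \<approx> dyadic_game m k + dyadic_game n k + dyadic_game 1 k"
      using game_eq_add[OF game_eq_refl game_eq_sym[OF dyadic_game_add_1]] by (simp add: add.assoc)
    have 2: "dyadic_game (m + (n + 1)) k \<approx> dyadic_game (m + n) k + dyadic_game 1 k"
      using game_eq_sym[OF dyadic_game_add_1[of "m + n" k]] by (simp add: add.assoc)
    show ?thesis
      using game_eq_le_cong[OF 1 2] game_eq_le_cong[OF 2 1] by (simp add: game_eq_def)
  qed
  show ?thesis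
  proof (induction n rule: int_induct[of _ 0])
    case (step1 i)
    then show ?case
      using step[of i] by blast
  next
    case (step2 i)
    then show ?case
      using step[of "i - 1"] by simp
  qed simp
qed

section \<open>Rational values of games: order, negation and sums\<close>

lemma has_value_dyadic_game: "has_value (dyadic_game m k) (of_int m / 2 ^ k)"
  unfolding has_value_def using game_eq_refl by blast

lemma has_value_0: "has_value 0 0"
  using has_value_dyadic_game[of 0 0] unfolding dyadic_game_0 by simp

lemma has_value_cong: "G \<approx> H \<Longrightarrow> has_value G q \<Longrightarrow> has_value H q"
  unfolding has_value_def by (metis game_eq_sym game_eq_trans)

lemma has_value_common_denominator:
  assumes "has_value G p" "has_value H q"
  obtains m n k where "p = of_int m / 2 ^ k" "q = of_int n / 2 ^ k"
    "G \<approx> dyadic_game m k" "H \<approx> dyadic_game n k"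
proof -
  obtain m i n j where "p = of_int m / 2 ^ i" "G \<approx> dyadic_game m i"
    and "q = of_int n / 2 ^ j" "H \<approx> dyadic_game n j"
    using assms by (auto simp: has_value_def)
  then show ?thesis
    using that[of "m * 2 ^ j" "i + j" "n * 2 ^ i"]
      dyadic_game_scale[of m j i] dyadic_game_scale[of n i j]
    by (simp add: power_add field_simps)
qed

lemma has_value_le_iff:
  assumes "has_value G p" "has_value H q"
  shows "G \<lesssim> H \<longleftrightarrow> p \<le> q"
proof -
  from assms obtain m n k where *: "p = of_int m / 2 ^ k" "q = of_int n / 2 ^ k"
    "G \<approx> dyadic_game m k" "H \<approx> dyadic_game n k"
    by (rule has_value_common_denominator)
  show ?thesis
    unfolding game_eq_le_cong[OF *(3,4)] dyadic_game_le_iff by (simp add: *(1,2) divide_le_cancel)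
qed

lemma has_value_eq_iff: "has_value G p \<Longrightarrow> has_value H q \<Longrightarrow> G \<approx> H \<longleftrightarrow> p = q"
  by (auto simp: game_eq_def has_value_le_iff)

lemma has_value_uminus: "has_value G q \<Longrightarrow> has_value (- G) (- q)"
  unfolding has_value_def
  by (metis game_eq_uminus_iff uminus_dyadic_game of_int_minus minus_divide_left)

lemma has_value_add:
  assumes "has_value G p" "has_value H q"
  shows "has_value (G + H) (p + q)"
proof -
  from assms obtain m n k where *: "p = of_int m / 2 ^ k" "q = of_int n / 2 ^ k"
    "G \<approx> dyadic_game m k" "H \<approx> dyadic_game n k"
    by (rule has_value_common_denominator)
  have "G + H \<approx> dyadic_game (m + n) k"
    using game_eq_add[OF *(3,4)] dyadic_game_add by (rule game_eq_trans)
  then show ?thesis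
    using * by (auto simp: has_value_def add_divide_distrib[symmetric] intro!: exI[of _ "m + n"] exI[of _ k])
qed

text \<open>Halving keeps the numerator of the sum and raises the exponent by one. The midpoint will
  separate two stops that are supposed to differ.\<close>

lemma has_value_between:
  assumes "has_value G p" "has_value H q"
  shows "\<exists>J. has_value J ((p + q) / 2)"
proof -
  obtain m k where "p + q = of_int m / 2 ^ k"
    using has_value_add[OF assms] by (auto simp: has_value_def)
  then show ?thesis
    using has_value_dyadic_game[of m "Suc k"] by (auto simp: mult.commute)
qed

lemma dyadic_game_option:
  "X |\<in>| left_opts (dyadic_game m k) \<or> X |\<in>| right_opts (dyadic_game m k) \<Longrightarrow>
    \<exists>n j. X = dyadic_game n j"
proof (induction k arbitrary: m)
  case 0
  then have "X = int_game (m - 1) \<or> X = int_game (m + 1)"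
    by (auto simp: left_opts_int_game right_opts_int_game split: if_splits)
  then show ?case
    unfolding dyadic_game.simps(1)[symmetric] by blast
next
  case (Suc k)
  show ?case
  proof (cases "even m")
    case True
    with Suc show ?thesis
      by simp
  next
    case False
    with Suc(2) show ?thesis
      by auto
  qed
qed

lemma dyadic_game_le_right_option: "X |\<in>| right_opts (dyadic_game m k) \<Longrightarrow> dyadic_game m k \<lesssim> X"
  and dyadic_game_ge_left_option: "X |\<in>| left_opts (dyadic_game m k) \<Longrightarrow> X \<lesssim> dyadic_game m k"
  using dyadic_game_step(1)[of m k] dyadic_game_step(1)[of "m - 1" k] dyadic_game_step(3,4)[of X m k]
  by (auto intro: game_le_trans)

text \<open>The simplicity theorem: \<open>G\<close> equals the smallest number that fits between its options.\<close>

lemma is_number_if_fits: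
  assumes "has_value D q" "\<And>X. X |\<in>| left_opts G \<Longrightarrow> \<not> D \<lesssim> X" "\<And>Y. Y |\<in>| right_opts G \<Longrightarrow> \<not> Y \<lesssim> D"
  shows "is_number G"
proof -
  define fits where "fits D \<longleftrightarrow> (\<exists>m k. D = dyadic_game m k) \<and>
    (\<forall>X. X |\<in>| left_opts G \<longrightarrow> \<not> D \<lesssim> X) \<and> (\<forall>Y. Y |\<in>| right_opts G \<longrightarrow> \<not> Y \<lesssim> D)" for D
  obtain m k where "D \<approx> dyadic_game m k"
    using assms(1) by (auto simp: has_value_def)
  then have "fits (dyadic_game m k)"
    using assms(2,3) by (auto simp: fits_def game_eq_le_left game_eq_le_right)
  then obtain E where E: "fits E" and least: "\<And>E'. fits E' \<Longrightarrow> size E \<le> size E'"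
    by (metis arg_min_natI arg_min_nat_le)
  then obtain n j where Enj: "E = dyadic_game n j"
    by (auto simp: fits_def)
  have "G \<lesssim> E"
  proof (rule game_leI)
    fix Y assume Y: "Y |\<in>| right_opts E"
    \<comment> \<open>An option of \<open>E\<close> is a smaller dyadic form, so it cannot fit.
      Lying above \<open>E\<close>, it still passes the test against the Left options of
      \<open>G\<close>, so some Right option of \<open>G\<close> must be at or below it.\<close>
    then have "\<not> fits Y"
      using least[of Y] size_right_option[of Y E] by auto
    moreover have "E \<lesssim> Y" "\<exists>m k. Y = dyadic_game m k"
      using Y dyadic_game_le_right_option dyadic_game_option unfolding Enj by blast+
    ultimately have "\<exists>X. X |\<in>| right_opts G \<and> X \<lesssim> Y"
      using E by (auto simp: fits_def intro: game_le_trans)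
    then show "\<not> Y \<lesssim> G"
      using not_game_le_right by blast
  qed (use E in \<open>auto simp: fits_def\<close>)
  moreover have "E \<lesssim> G"
  proof (rule game_leI)
    fix X assume X: "X |\<in>| left_opts E"
    then have "\<not> fits X"
      using least[of X] size_left_option[of X E] by auto
    moreover have "X \<lesssim> E" "\<exists>m k. X = dyadic_game m k"
      using X dyadic_game_ge_left_option dyadic_game_option unfolding Enj by blast+
    ultimately have "\<exists>Y. Y |\<in>| left_opts G \<and> X \<lesssim> Y"
      using E by (auto simp: fits_def intro: game_le_trans)
    then show "\<not> G \<lesssim> X"
      using not_game_le_left by blast
  qed (use E in \<open>auto simp: fits_def\<close>)
  ultimately show ?thesis
    using Enj by (auto simp: is_number_def has_value_def game_eq_def)
qed

subsection \<open>Stops\<close>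

text \<open>The number \<open>l\<close> is the Left stop of \<open>G\<close>, described without reference to play.\<close>

definition left_stop :: "game \<Rightarrow> rat \<Rightarrow> bool" where
  "left_stop G l \<longleftrightarrow> (\<forall>P p. has_value P p \<longrightarrow> (l < p \<longrightarrow> G \<lesssim> P) \<and> (p < l \<longrightarrow> \<not> G \<lesssim> P))"

text \<open>A number is its own stop. Otherwise the stop is the largest Right stop
  \<open>- r X\<close> among the Left options \<open>X\<close>, and it is realised by
  \<open>- A X\<close>, which is no higher than \<open>X\<close> and so strictly lower than
  \<open>G\<close>. Carrying the witness \<open>A\<close> along makes this height comparison
  possible.\<close>

lemma left_stop_exists:
  "\<exists>A l. has_value A l \<and> left_stop G l \<and> height A \<le> height G \<and> (\<not> is_number G \<longrightarrow> height A < height G)"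
proof (induction "size G" arbitrary: G rule: less_induct)
  case less
  show ?case
  proof (cases "is_number G")
    case True
    then obtain q where q: "has_value G q"
      by (auto simp: is_number_def)
    then have "left_stop G q"
      by (auto simp: left_stop_def has_value_le_iff)
    moreover have "has_value (canonical_form G) q" "height (canonical_form G) \<le> height G"
      using has_value_cong[OF game_eq_sym[OF canonical_form_eq] q] birthday_le_height[of G]
      by (simp_all add: birthday_def)
    ultimately show ?thesis
      using True by blast
  next
    case False
    have "\<exists>l. left_stop X l" if "X |\<in>| right_opts G" for X
      using less[of X] size_right_option[OF that] by blast
    then obtain s where s: "\<And>X. X |\<in>| right_opts G \<Longrightarrow> left_stop X (s X)"
      by metis
    \<comment> \<open>Right stops are expressed as negated Left stops of \<open>- X\<close>;
      negation preserves the size, so the induction hypothesis applies.\<close>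
    have "\<exists>l A. left_stop (- X) l \<and> has_value A l \<and> height A \<le> height X" if "X |\<in>| left_opts G" for X
      using less[of "- X"] size_left_option[OF that] by auto
    then obtain r A where r: "\<And>X. X |\<in>| left_opts G \<Longrightarrow> left_stop (- X) (r X)"
      "\<And>X. X |\<in>| left_opts G \<Longrightarrow> has_value (A X) (r X)"
      "\<And>X. X |\<in>| left_opts G \<Longrightarrow> height (A X) \<le> height X"
      by metis
    have above: "\<not> P \<lesssim> X" if "X |\<in>| left_opts G" "has_value P p" "- r X < p" for X P p
      using r(1)[OF that(1)] has_value_uminus[OF that(2)] that(3)
      unfolding left_stop_def by (metis game_le_uminus_iff minus_less_iff)
    have below: "P \<lesssim> X" if "X |\<in>| left_opts G" "has_value P p" "p < - r X" for X P p
      using r(1)[OF that(1)] has_value_uminus[OF that(2)] that(3)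
      unfolding left_stop_def by (metis game_le_uminus_iff less_minus_iff)
    have "left_opts G \<noteq> {||}"
    proof
      assume empty: "left_opts G = {||}"
      \<comment> \<open>An integer strictly below the Left stops of all Right options fits in
        \<open>G\<close>, which has no Left options. Inserting 0 keeps \<open>Min\<close> meaningful
        when Right has no options either, and subtracting 1 makes the bound strict.\<close>
      define n where "n = \<lfloor>Min (insert 0 (s ` fset (right_opts G)))\<rfloor> - 1"
      have n: "of_int n < s Y" if "Y |\<in>| right_opts G" for Y
      proof -
        have "Min (insert 0 (s ` fset (right_opts G))) \<le> s Y"
          using that by (intro Min_le) auto
        then show ?thesis
          unfolding n_def by linarith
      qed
      have D: "has_value (dyadic_game n 0) (of_int n)"
        using has_value_dyadic_game[of n 0] by simp
      have "is_number G"
      proof (rule is_number_if_fits[OF D])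
        show "\<not> Y \<lesssim> dyadic_game n 0" if "Y |\<in>| right_opts G" for Y
          using s[OF that] n[OF that] D unfolding left_stop_def by blast
      qed (simp add: empty)
      with False show False ..
    qed
    define l where "l = Max ((\<lambda>X. - r X) ` fset (left_opts G))"
    have "l \<in> (\<lambda>X. - r X) ` fset (left_opts G)"
      unfolding l_def using \<open>left_opts G \<noteq> {||}\<close> by (intro Max_in) auto
    then obtain X where X: "X |\<in>| left_opts G" "l = - r X"
      by auto
    have max: "- r Z \<le> l" if "Z |\<in>| left_opts G" for Z
      unfolding l_def using that by (intro Max_ge) auto
    \<comment> \<open>A number above \<open>l\<close> passes the test against every Left option. As
      \<open>G\<close> is not a number, the simplicity theorem leaves only a Right option at or
      below \<open>P\<close> as the obstacle.\<close>
    have fuzzy: "\<not> P \<lesssim> G" if "has_value P p" "l < p" for P p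
    proof -
      have left: "\<not> P \<lesssim> Z" if "Z |\<in>| left_opts G" for Z
        using above[OF that \<open>has_value P p\<close>] max[OF that] \<open>l < p\<close> by simp
      then obtain Y where "Y |\<in>| right_opts G" "Y \<lesssim> P"
        using is_number_if_fits[OF \<open>has_value P p\<close> left] False by blast
      then show ?thesis
        by (rule not_game_le_right)
    qed
    \<comment> \<open>A concrete dyadic form is chosen for \<open>P\<close> because its Right
      options are again numbers, at least \<open>p\<close> and hence above \<open>l\<close>, to
      which \<open>fuzzy\<close> applies.\<close>
    have upper: "G \<lesssim> P" if P: "has_value P p" "l < p" for P p
    proof -
      obtain m k where mk: "P \<approx> dyadic_game m k" "p = of_int m / 2 ^ k"
        using P by (auto simp: has_value_def)
      have "G \<lesssim> dyadic_game m k"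
      proof (rule game_leI)
        show "\<not> dyadic_game m k \<lesssim> Z" if "Z |\<in>| left_opts G" for Z
          using above[OF that has_value_dyadic_game[of m k]] max[OF that] P mk by simp
      next
        fix Y assume Y: "Y |\<in>| right_opts (dyadic_game m k)"
        then obtain n j where nj: "Y = dyadic_game n j"
          using dyadic_game_option by blast
        have "dyadic_game m k \<lesssim> Y"
          using Y by (rule dyadic_game_le_right_option)
        then have "p \<le> of_int n / 2 ^ j"
          using has_value_le_iff[OF has_value_dyadic_game has_value_dyadic_game] by (simp add: nj mk)
        then show "\<not> Y \<lesssim> G"
          using fuzzy[OF has_value_dyadic_game, of n j] P by (simp add: nj)
      qed
      with mk show ?thesis
        by (simp add: game_eq_le_right)
    qed
    have lower: "\<not> G \<lesssim> P" if "has_value P p" "p < l" for P p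
      using below[OF X(1) that(1)] that(2) X not_game_le_left by blast
    have "height (- A X) < height G"
      using r(3)[OF X(1)] height_option(1)[OF X(1)] by simp
    moreover have "has_value (- A X) l"
      using has_value_uminus r(2) X by blast
    moreover have "left_stop G l"
      using upper lower by (auto simp: left_stop_def)
    ultimately show ?thesis
      using less_imp_le by blast
  qed
qed

text \<open>The Right stop of \<open>H\<close> is \<open>- b\<close>. Comparing \<open>G\<close>
  with \<open>P\<close> amounts to comparing \<open>- H\<close> with \<open>P + - x\<close>, so
  translation by \<open>q\<close> carries the stop of \<open>- H\<close> to that of
  \<open>G\<close>. The games \<open>A\<close> and \<open>B\<close> certify that both stops are
  dyadic.\<close>

lemma decomposition_left_stops:
  assumes GH: "x \<approx> G + H" and q: "has_value x q"
    and a: "left_stop G a" "has_value A a" and b: "left_stop (- H) b" "has_value B b"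
  shows "q = a - b"
proof -
  have iff: "G \<lesssim> P \<longleftrightarrow> - H \<lesssim> P + - x" for P
  proof -
    have "G \<lesssim> P \<longleftrightarrow> (G + H) + - H \<lesssim> P"
      using game_add_diff_cancel[of G H] by (simp add: game_eq_le_left)
    also have "\<dots> \<longleftrightarrow> x + - H \<lesssim> P"
      using game_eq_le_left[OF game_eq_add[OF GH game_eq_refl]] by blast
    also have "\<dots> \<longleftrightarrow> - H \<lesssim> P + - x"
      using game_le_diff_iff[of "- H" x P] by (simp add: add.commute)
    finally show ?thesis .
  qed
  \<comment> \<open>If \<open>a\<close> and \<open>q + b\<close> differed, a number halfway between
    them would lie on opposite sides of the two stops and contradict \<open>iff\<close>.\<close>
  obtain P where P: "has_value P ((a + (q + b)) / 2)"
    using has_value_between[OF a(2) has_value_add[OF q b(2)]] by blast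
  then have "has_value (P + - x) ((a + (q + b)) / 2 - q)"
    using has_value_add has_value_uminus[OF q] by fastforce
  then have "((b < (a + (q + b)) / 2 - q) \<longrightarrow> - H \<lesssim> P + - x) \<and> ((a + (q + b)) / 2 - q < b \<longrightarrow> \<not> - H \<lesssim> P + - x)"
    using b(1) unfolding left_stop_def by blast
  moreover have "((a < (a + (q + b)) / 2) \<longrightarrow> G \<lesssim> P) \<and> ((a + (q + b)) / 2 < a \<longrightarrow> \<not> G \<lesssim> P)"
    using a(1) P unfolding left_stop_def by blast
  ultimately show ?thesis
    using iff[of P] by (cases a "q + b" rule: linorder_cases) (auto simp: field_simps)
qed

section \<open>From stops to birthdays of summands\<close>

lemma left_stop_cong: "G \<approx> H \<Longrightarrow> left_stop G l \<Longrightarrow> left_stop H l"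
  by (auto simp: left_stop_def game_eq_le_left)

lemma is_number_cong: "G \<approx> H \<Longrightarrow> is_number G \<Longrightarrow> is_number H"
  unfolding is_number_def using has_value_cong by blast

text \<open>Stops depend on the value only, so passing to the canonical form turns the strict height
  bound into one between birthdays.\<close>

lemma left_stop_birthday:
  assumes "\<not> is_number G"
  shows "\<exists>A a. has_value A a \<and> left_stop G a \<and> birthday A < birthday G"
proof -
  have "\<not> is_number (canonical_form G)"
    using assms is_number_cong[OF canonical_form_eq] by blast
  then obtain A a where "has_value A a" "left_stop (canonical_form G) a" "height A < birthday G"
    using left_stop_exists[of "canonical_form G"] by (auto simp: birthday_def)
  then show ?thesis
    using left_stop_cong[OF canonical_form_eq] birthday_le_height le_less_trans by blast
qed

lemma minimal_form_birthday: "minimal_form K \<Longrightarrow> K \<approx> G \<Longrightarrow> birthday G = height K"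
  unfolding birthday_def by (metis canonical_form_eqI minimal_form_canonical)

lemma birthday_uminus: "birthday (- G) = birthday G"
proof -
  obtain K where "minimal_form K" "K \<approx> G"
    using minimal_form_exists by blast
  then show ?thesis
    using minimal_form_birthday[of K G] minimal_form_birthday[of "- K" "- G"] minimal_form_uminus[of K]
    by simp
qed

lemma strong_decomposition_number:
  assumes "has_value x q" "strong_decomposition x G H"
  shows "is_number G"
proof (rule ccontr)
  assume G: "\<not> is_number G"
  have GH: "x \<approx> G + H" and birth: "birthday G + birthday H = birthday x"
    using assms(2) by (simp_all add: strong_decomposition_def)
  have H: "\<not> is_number (- H)"
  proof
    assume "is_number (- H)"
    then obtain h where "has_value (- H) h"
      by (auto simp: is_number_def)
    moreover have "x + - H \<approx> G"
      using game_eq_add[OF GH game_eq_refl] game_add_diff_cancel by (rule game_eq_trans)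
    ultimately have "has_value G (q + h)"
      using has_value_add[OF assms(1)] has_value_cong by blast
    with G show False
      by (auto simp: is_number_def)
  qed
  obtain A a where A: "has_value A a" "left_stop G a" "birthday A < birthday G"
    using left_stop_birthday[OF G] by blast
  obtain B b where B: "has_value B b" "left_stop (- H) b" "birthday B < birthday H"
    using left_stop_birthday[OF H] by (auto simp: birthday_uminus)
  \<comment> \<open>Since \<open>b\<close> belongs to \<open>- H\<close>, the second stop enters
    with a minus sign; this leaves its birthday unchanged.\<close>
  have "has_value (A + - B) q"
    using has_value_add[OF A(1) has_value_uminus[OF B(1)]]
      decomposition_left_stops[OF GH assms(1) A(2,1) B(2,1)] by simp
  then have "birthday x = birthday (A + - B)"
    using has_value_eq_iff[OF assms(1)] by (intro birthday_cong) blast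
  also have "\<dots> \<le> birthday A + birthday B"
    using birthday_plus_le[of A "- B"] by (simp add: birthday_uminus)
  finally show False
    using A B birth by simp
qed

subsection \<open>Birthdays of dyadic rationals\<close>

lemma canonical_int_game: "canonical (int_game m)"
proof -
  have pos: "canonical (nat_game n)" for n
  proof (induction n)
    case (Suc n)
    have "right_opts (nat_game n) = {||}"
      by (cases n) simp_all
    with Suc show ?case
      by - (rule canonicalI; auto simp: has_dominated_option_def has_reversible_option_def)
  qed (rule canonicalI; auto simp: has_dominated_option_def has_reversible_option_def)
  have neg: "canonical (- nat_game n)" for n
  proof (induction n)
    case (Suc n)
    have "left_opts (- nat_game n) = {||}"
      by (cases n) simp_all
    with Suc show ?case
      by - (rule canonicalI; auto simp: has_dominated_option_def has_reversible_option_def)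
  qed (use pos[of 0] in simp)
  show ?thesis
    using pos neg by (simp add: int_game_def)
qed

text \<open>An option of the left neighbour \<open>a\<close> through which Left's move could reverse
  is at least \<open>a + 1\<close>, which is a Right option of \<open>Q\<close> and thus not below
  \<open>Q\<close>; the other side is dual. Hence the birthday of a number is the height of its
  dyadic form.\<close>

lemma canonical_dyadic_game: "canonical (dyadic_game m k)"
proof (induction k arbitrary: m)
  case 0
  show ?case
    by (simp add: canonical_int_game)
next
  case (Suc k)
  show ?case
  proof (cases "even m")
    case True
    with Suc show ?thesis
      by simp
  next
    case False
    then obtain a where m: "m = 2 * a + 1" by (rule oddE)
    define Q where "Q = dyadic_game m (Suc k)"
    have Q: "left_opts Q = {|dyadic_game a k|}" "right_opts Q = {|dyadic_game (a + 1) k|}"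
      unfolding Q_def m dyadic_game_odd by simp_all
    have "\<not> Y \<lesssim> Q" if "Y |\<in>| right_opts (dyadic_game a k)" for Y
      using dyadic_game_step(4)[OF that] by (intro not_game_le_right[of "dyadic_game (a + 1) k"]) (simp_all add: Q)
    moreover have "\<not> Q \<lesssim> X" if "X |\<in>| left_opts (dyadic_game (a + 1) k)" for X
      using dyadic_game_step(3)[OF that] by (intro not_game_le_left[of "dyadic_game a k"]) (simp_all add: Q)
    ultimately have "\<not> has_reversible_option Q" "\<not> has_dominated_option Q"
      by (auto simp: has_reversible_option_def has_dominated_option_def Q)
    then have "canonical Q"
      by - (rule canonicalI; use Suc in \<open>auto simp: Q\<close>)
    then show ?thesis
      by (simp only: Q_def)
  qed
qed

lemma birthday_dyadic_game: "birthday (dyadic_game m k) = height (dyadic_game m k)"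
  unfolding birthday_def by (simp only: canonical_form_eqI[OF canonical_dyadic_game game_eq_refl])

lemma height_nat_game: "height (nat_game n) = n"
  by (induction n) (simp_all add: zero_game_def)

text \<open>The shift by \<open>2 ^ k\<close> adds the integer 1. For an odd numerator both
  neighbours are nonnegative and shift along with it. Below 0 the claim fails: going from -1 to 0
  lowers the height.\<close>

lemma height_dyadic_game_add_1:
  "0 \<le> m \<Longrightarrow> height (dyadic_game (m + 2 ^ k) k) = Suc (height (dyadic_game m k))"
proof (induction k arbitrary: m)
  case 0
  then show ?case
    by (simp add: int_game_def height_nat_game nat_add_distrib)
next
  case (Suc k)
  show ?case
  proof (cases "even m")
    case True
    then obtain a where m: "m = 2 * a" ..
    then have "m + 2 ^ Suc k = 2 * (a + 2 ^ k)"
      by simp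
    then show ?thesis
      using Suc m by (simp only: dyadic_game_even)
  next
    case False
    then obtain a where m: "m = 2 * a + 1" by (rule oddE)
    then have m': "m + 2 ^ Suc k = 2 * (a + 2 ^ k) + 1"
      by simp
    have "0 \<le> a"
      using m Suc by simp
    then have IH: "height (dyadic_game (a + 2 ^ k) k) = Suc (height (dyadic_game a k))"
      "height (dyadic_game (a + 2 ^ k + 1) k) = Suc (height (dyadic_game (a + 1) k))"
      using Suc.IH[of a] Suc.IH[of "a + 1"] by (simp_all add: add_ac)
    show ?thesis
      unfolding m' unfolding m dyadic_game_odd by (simp add: IH)
  qed
qed

lemma height_dyadic_game_abs: "height (dyadic_game m k) = height (dyadic_game \<bar>m\<bar> k)"
  using height_uminus[of "dyadic_game m k"] by (simp add: uminus_dyadic_game abs_if)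

lemma strongly_decomposable_number:
  assumes "has_value x q" "\<bar>q\<bar> > 1"
  shows "strongly_decomposable x"
proof -
  obtain m k where mk: "q = of_int m / 2 ^ k" "x \<approx> dyadic_game m k"
    using assms by (auto simp: has_value_def)
  have "2 ^ k < \<bar>rat_of_int m\<bar>"
    using assms(2) by (simp add: mk abs_divide)
  also have "\<bar>rat_of_int m\<bar> = rat_of_int \<bar>m\<bar>"
    by simp
  finally have large: "2 ^ k < \<bar>m\<bar>"
    by (metis of_int_less_iff of_int_numeral of_int_power)
  \<comment> \<open>The fraction \<open>s / 2 ^ k\<close> is 1 with the sign of \<open>m\<close>.
    Subtracting it moves \<open>m\<close> towards 0 without reaching it, because
    \<open>\<bar>m\<bar>\<close> exceeds \<open>2 ^ k\<close>; so the height drops by exactly one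
    and the remainder is nonzero.\<close>
  define s where "s = sgn m * 2 ^ k"
  have "\<bar>s\<bar> = 2 ^ k" "\<bar>m - s\<bar> = \<bar>m\<bar> - 2 ^ k"
    using large by (auto simp: s_def sgn_if)
  then have "height (dyadic_game s k) = 1" "height (dyadic_game (m - s) k) + 1 = height (dyadic_game m k)"
    using height_dyadic_game_add_1[of 0 k] height_dyadic_game_add_1[of "\<bar>m\<bar> - 2 ^ k" k] large
      height_dyadic_game_abs[of s k] height_dyadic_game_abs[of "m - s" k] height_dyadic_game_abs[of m k]
    by (simp_all add: zero_game_def)
  then have "birthday (dyadic_game s k) + birthday (dyadic_game (m - s) k) = birthday x"
    using birthday_cong[OF mk(2)] by (simp add: birthday_dyadic_game)
  moreover have "dyadic_game n k \<approx> 0 \<longleftrightarrow> n = 0" for n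
    using has_value_eq_iff[OF has_value_dyadic_game[of n k] has_value_0] by simp
  then have "\<not> dyadic_game s k \<approx> 0" "\<not> dyadic_game (m - s) k \<approx> 0"
    using large \<open>\<bar>s\<bar> = 2 ^ k\<close> by auto
  moreover have "dyadic_game s k + dyadic_game (m - s) k \<approx> dyadic_game m k"
    using dyadic_game_add[of s k "m - s"] by simp
  then have "x \<approx> dyadic_game s k + dyadic_game (m - s) k"
    by (rule game_eq_trans[OF mk(2) game_eq_sym])
  ultimately show ?thesis
    unfolding strongly_decomposable_def strong_decomposition_def by blast
qed

theorem theorem15:
  fixes x :: game and q :: rat
  assumes "has_value x q"
    and "\<bar>q\<bar> > 1"
  shows "strongly_decomposable x \<and>
    (\<forall>G H. strong_decomposition x G H \<longrightarrow> is_number G \<and> is_number H)"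
proof (intro conjI allI impI)
  show "strongly_decomposable x"
    using assms by (rule strongly_decomposable_number)
next
  fix G H assume *: "strong_decomposition x G H"
  then have "strong_decomposition x H G"
    by (simp add: strong_decomposition_def add.commute)
  with * show "is_number G" "is_number H"
    using strong_decomposition_number assms(1) by blast+
qed

end
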